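(* Let $k$ be a positive integer and let $d$ be a real number with $1 \leq d < k$. If $\mathcal{H}$ is a nonempty $k$-uniform hypergraph with degree bound $d$, then $$\frac{|\sigma(\mathcal{H})|}{|\mathcal{H}|} \geq k - \frac{d-1}{2}.$$
   Context: A $k$-uniform hypergraph on $[n]=\{1,\ldots,n\}$ ($n$ a positive integer) is a family $\mathcal{H} \subset \binom{[n]}{k}$ of $k$-element subsets of $[n]$, called hyperedges; $|\mathcal{H}|$ is the number of hyperedges. The shadow of $\mathcal{H}$ is $\sigma(\mathcal{H}) = \{S \in \binom{[n]}{k-1} : \exists H \in \mathcal{H},\ S \subset H\}$. The maximum degree is $\Delta(\mathcal{H}) = \max_{v \in [n]} |\{H \in \mathcal{H} : v \in H\}|$, and a degree bound of $\mathcal{H}$ is any real number $d$ with $\Delta(\mathcal{H}) \leq d$. *)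

theory Defs
  imports Complex_Main "HOL-Library.Ramsey"
begin

text \<open>The vertex set is \<^term>\<open>{1..n}\<close>; \<^term>\<open>nsets A k\<close> is the family of all
  \<open>k\<close>-element subsets of \<open>A\<close>.\<close>

definition uniform_hypergraph :: "nat \<Rightarrow> nat \<Rightarrow> nat set set \<Rightarrow> bool" where
  "uniform_hypergraph n k H \<longleftrightarrow> H \<subseteq> nsets {1..n} k"

text \<open>The subtraction \<^term>\<open>k - 1\<close> is on natural numbers, so this is meant for \<^term>\<open>k \<ge> 1\<close>.\<close>

definition shadow :: "nat \<Rightarrow> nat \<Rightarrow> nat set set \<Rightarrow> nat set set" where
  "shadow n k H = {S \<in> nsets {1..n} (k - 1). \<exists>E\<in>H. S \<subseteq> E}"

definition degree :: "nat set set \<Rightarrow> nat \<Rightarrow> nat" where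
  "degree H v = card {E \<in> H. v \<in> E}"

text \<open>Meant for \<^term>\<open>n \<ge> 1\<close>, as \<^const>\<open>Max\<close> is unspecified on the empty set.\<close>

definition max_degree :: "nat \<Rightarrow> nat set set \<Rightarrow> nat" where
  "max_degree n H = Max (degree H ` {1..n})"

definition degree_bound :: "nat \<Rightarrow> nat set set \<Rightarrow> real \<Rightarrow> bool" where
  "degree_bound n H d \<longleftrightarrow> real (max_degree n H) \<le> d"

end

theory Submission
  imports Defs
begin

text \<open>
  Write \<open>m(S)\<close> for the number of edges that contain a set \<open>S\<close> of the shadow. Counting the pairs
  \<open>S \<subset> E\<close> in two ways gives \<open>k |H| = \<Sum> m(S)\<close>, and by the Bonferroni
  inequality \<open>1 \<ge> m - m (m - 1) / 2\<close> the loss \<open>k |H| - |\<sigma>(H)|\<close> is at most the number of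
  unordered pairs of distinct edges that share a set of the shadow, counted with the sets they
  share (\<open>card_shadow_bonferroni\<close>).

  It remains to see that an edge \<open>E\<close> belongs to at most \<open>D - 1\<close> such pairs if all degrees are
  at most \<open>D < k\<close> (\<open>adjacent_edges_less_degree\<close>). Each edge adjacent to \<open>E\<close> meets it in
  \<open>k - 1\<close> vertices, whereas each of the \<open>k\<close> vertices of \<open>E\<close> lies in at most \<open>D - 1\<close> other edges,
  so there are at most \<open>k (D - 1) / (k - 1)\<close> adjacent edges. This is less than \<open>D\<close>,
  precisely because \<open>D < k\<close>. Every edge thus accounts for a loss of at most \<open>(D - 1) / 2\<close>.
\<close>

lemma uniform_hypergraph_edgeD:
  assumes "uniform_hypergraph n k H" and "E \<in> H"
  shows "E \<subseteq> {1..n}" "finite E" "card E = k"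
  using assms by (auto simp: uniform_hypergraph_def nsets_def)

lemma uniform_hypergraph_finite: "uniform_hypergraph n k H \<Longrightarrow> finite H"
  unfolding uniform_hypergraph_def by (meson finite_atLeastAtMost finite_imp_finite_nsets finite_subset)

lemma finite_shadow: "finite (shadow n k H)"
  unfolding shadow_def by (simp add: finite_imp_finite_nsets)

lemma shadow_card: "S \<in> shadow n k H \<Longrightarrow> card S = k - 1"
  by (simp add: shadow_def nsets_def)

lemma card_shadow_of_edge:
  assumes "k \<ge> 1" and "uniform_hypergraph n k H" and "E \<in> H"
  shows "card {S \<in> shadow n k H. S \<subseteq> E} = k"
proof -
  note E = uniform_hypergraph_edgeD[OF assms(2,3)]
  have "{S \<in> shadow n k H. S \<subseteq> E} = {S. S \<subseteq> E \<and> card S = k - 1}"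
    using E assms(3) finite_subset[OF _ E(2)] by (auto simp: shadow_def nsets_def)
  also have "card \<dots> = k choose (k - 1)"
    using E by (simp add: n_subsets)
  also have "\<dots> = k"
    using assms(1) by (cases k) auto
  finally show ?thesis .
qed

text \<open>Distinct edges share at most one set of the shadow, and if they share one then it is
  their whole intersection.\<close>

lemma common_shadow_le_card_Int:
  assumes "k \<ge> 1" and "uniform_hypergraph n k H" and "E \<in> H" and "E' \<in> H" and "E' \<noteq> E"
  shows "(k - 1) * card {S \<in> shadow n k H. S \<subseteq> E \<inter> E'} \<le> card (E \<inter> E')"
proof -
  note E = uniform_hypergraph_edgeD[OF assms(2,3)] uniform_hypergraph_edgeD[OF assms(2,4)]
  have fin: "finite (E \<inter> E')" using E by simp
  have "E \<inter> E' \<subset> E"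
    using E assms(5) by (metis card_subset_eq inf.absorb_iff2 inf_le1 inf_le2 psubsetI)
  then have less: "card (E \<inter> E') \<le> k - 1"
    using E by (metis Suc_diff_1 assms(1) less_Suc_eq_le less_le_trans psubset_card_mono zero_less_one)
  have eq: "S = E \<inter> E'" if "S \<in> shadow n k H" "S \<subseteq> E \<inter> E'" for S
    using that shadow_card[OF that(1)] less fin by (simp add: card_seteq)
  show ?thesis
  proof (cases "E \<inter> E' \<in> shadow n k H")
    case True
    then have "{S \<in> shadow n k H. S \<subseteq> E \<inter> E'} = {E \<inter> E'}" using eq by blast
    then show ?thesis using shadow_card[OF True] by simp
  next
    case False
    then have "{S \<in> shadow n k H. S \<subseteq> E \<inter> E'} = {}" using eq by blast
    then show ?thesis by (simp only: card.empty)
  qed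
qed

text \<open>Double counting the incidences of the vertices of \<open>E\<close> with the other edges bounds
  \<open>\<Sum> |E \<inter> E'|\<close> by \<open>k (D - 1) = (k - 1) (D - 1) + (D - 1)\<close>, which is less than
  \<open>(k - 1) D\<close>.\<close>

lemma adjacent_edges_less_degree:
  assumes "k \<ge> 1" and H: "uniform_hypergraph n k H" and E: "E \<in> H"
    and deg: "\<And>v. v \<in> E \<Longrightarrow> degree H v \<le> D" and "D < k"
  shows "(\<Sum>E'\<in>H - {E}. card {S \<in> shadow n k H. S \<subseteq> E \<inter> E'}) < D"
    (is "?adj < D")
proof -
  note edge = uniform_hypergraph_edgeD[OF H E]
  have finH: "finite H" using uniform_hypergraph_finite[OF H] .
  have others: "card {E' \<in> H - {E}. v \<in> E'} < D" if "v \<in> E" for v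
  proof -
    have "{E' \<in> H - {E}. v \<in> E'} \<subset> {E' \<in> H. v \<in> E'}" using that E by blast
    then have "card {E' \<in> H - {E}. v \<in> E'} < degree H v"
      unfolding degree_def using finH by (intro psubset_card_mono) auto
    then show ?thesis using deg[OF that] by simp
  qed
  obtain v where "v \<in> E" using edge assms(1) by fastforce
  then have "D > 0" using others by fastforce
  then obtain c where c: "D = Suc c" by (cases D) auto
  have "(k - 1) * ?adj \<le> (\<Sum>E'\<in>H - {E}. card (E \<inter> E'))"
    unfolding sum_distrib_left
    using assms(1) H E by (intro sum_mono common_shadow_le_card_Int) auto
  also have "\<dots> = (\<Sum>v\<in>E. card {E' \<in> H - {E}. v \<in> E'})"
    using sum_multicount_gen[of "H - {E}" E "\<lambda>E' v. v \<in> E'"] finH edge by (simp add: Int_def)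
  also have "\<dots> \<le> k * c"
    using sum_bounded_above[of E "\<lambda>v. card {E' \<in> H - {E}. v \<in> E'}" c] others edge
    by (simp add: c less_Suc_eq_le)
  also have "\<dots> = (k - 1) * c + c" using assms(1) by (cases k) auto
  also have "\<dots> < (k - 1) * D" using assms(5) c by simp
  finally show ?thesis by simp
qed

text \<open>For \<open>S\<close> in the shadow, \<open>m(S) (m(S) - 1)\<close> counts the ordered pairs of distinct edges
  containing \<open>S\<close>; the factor 2 makes room for both orders and keeps the inequality in the
  natural numbers.\<close>

lemma card_shadow_bonferroni:
  assumes "k \<ge> 1" and H: "uniform_hypergraph n k H"
  shows "2 * (k * card H) \<le> 2 * card (shadow n k H)
    + (\<Sum>E\<in>H. \<Sum>E'\<in>H - {E}. card {S \<in> shadow n k H. S \<subseteq> E \<inter> E'})"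
proof -
  define m where "m S = card {E \<in> H. S \<subseteq> E}" for S :: "nat set"
  have finH: "finite H" using uniform_hypergraph_finite[OF H] .
  have incidences: "(\<Sum>S\<in>shadow n k H. m S) = k * card H"
    unfolding m_def
    using sum_multicount[of "shadow n k H" H "\<lambda>S E. S \<subseteq> E" k]
      card_shadow_of_edge[OF assms] finH finite_shadow by simp
  have pairs: "m S * (m S - 1) = (\<Sum>E | E \<in> H \<and> S \<subseteq> E. card {E' \<in> H - {E}. S \<subseteq> E'})" for S
  proof -
    have "card {E' \<in> H - {E}. S \<subseteq> E'} = m S - 1" if "E \<in> H" "S \<subseteq> E" for E
    proof -
      have "{E' \<in> H - {E}. S \<subseteq> E'} = {E' \<in> H. S \<subseteq> E'} - {E}" by blast
      then show ?thesis using that finH by (simp add: m_def)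
    qed
    then show ?thesis by (simp add: m_def)
  qed
  have "(\<Sum>S\<in>shadow n k H. m S * (m S - 1))
      = (\<Sum>E\<in>H. \<Sum>S | S \<in> shadow n k H \<and> S \<subseteq> E. card {E' \<in> H - {E}. S \<subseteq> E'})"
    unfolding pairs by (rule sum.swap_restrict[OF finite_shadow finH])
  also have "\<dots> = (\<Sum>E\<in>H. \<Sum>E'\<in>H - {E}. card {S \<in> shadow n k H. S \<subseteq> E \<inter> E'})"
  proof (rule sum.cong[OF refl])
    fix E
    show "(\<Sum>S | S \<in> shadow n k H \<and> S \<subseteq> E. card {E' \<in> H - {E}. S \<subseteq> E'})
        = (\<Sum>E'\<in>H - {E}. card {S \<in> shadow n k H. S \<subseteq> E \<inter> E'})"
      using sum_multicount_gen[of "{S \<in> shadow n k H. S \<subseteq> E}" "H - {E}" "\<lambda>S E'. S \<subseteq> E'"]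
        finH finite_shadow by simp
  qed
  finally have overlaps: "(\<Sum>S\<in>shadow n k H. m S * (m S - 1)) = \<dots>" .
  \<comment> \<open>Equivalently \<open>(m - 1) (m - 2) \<ge> 0\<close>, which holds for every natural number \<open>m\<close>.\<close>
  have "2 * m S \<le> 2 + m S * (m S - 1)" for S
  proof (cases "m S \<le> 2")
    case True
    then have "m S = 0 \<or> m S = 1 \<or> m S = 2" by linarith
    then show ?thesis by auto
  next
    case False
    then have "m S * 2 \<le> m S * (m S - 1)" by (intro mult_left_mono) auto
    then show ?thesis by linarith
  qed
  then have "(\<Sum>S\<in>shadow n k H. 2 * m S) \<le> (\<Sum>S\<in>shadow n k H. 2 + m S * (m S - 1))"
    by (intro sum_mono)
  then show ?thesis
    unfolding sum.distrib overlaps sum_distrib_left[symmetric] incidences by simp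
qed

theorem corollary1p3:
  fixes n k :: nat and d :: real and H :: "nat set set"
  assumes "n \<ge> 1" and "k \<ge> 1"
    and "1 \<le> d" and "d < real k"
    and "uniform_hypergraph n k H" and "H \<noteq> {}"
    and "degree_bound n H d"
  shows "real (card (shadow n k H)) / real (card H) \<ge> real k - (d - 1) / 2"
proof -
  define D where "D = max_degree n H"
  have Dd: "real D \<le> d" using assms(7) by (simp add: degree_bound_def D_def)
  then have Dk: "D < k" using assms(4) by simp
  have deg: "degree H v \<le> D" if "E \<in> H" "v \<in> E" for E v
    unfolding D_def max_degree_def
    using uniform_hypergraph_edgeD(1)[OF assms(5) that(1)] that(2) by (intro Max_ge) auto
  have card_pos: "card H > 0"
    using assms(6) uniform_hypergraph_finite[OF assms(5)] by (simp add: card_gt_0_iff)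
  let ?adj = "\<lambda>E. \<Sum>E'\<in>H - {E}. card {S \<in> shadow n k H. S \<subseteq> E \<inter> E'}"
  have adj: "real (?adj E) \<le> d - 1" if "E \<in> H" for E
  proof -
    have "?adj E < D"
      using adjacent_edges_less_degree[OF assms(2,5) that] deg[OF that] Dk by simp
    then show ?thesis using Dd by linarith
  qed
  have "real (\<Sum>E\<in>H. ?adj E) \<le> real (card H) * (d - 1)"
    unfolding of_nat_sum[of ?adj] using adj by (intro sum_bounded_above) simp
  moreover have "real (2 * (k * card H)) \<le> real (2 * card (shadow n k H) + (\<Sum>E\<in>H. ?adj E))"
    using card_shadow_bonferroni[OF assms(2,5)] by (simp only: of_nat_le_iff)
  ultimately have "2 * (real k * card H) \<le> 2 * real (card (shadow n k H)) + real (card H) * (d - 1)"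
    by simp
  then have "(real k - (d - 1) / 2) * real (card H) \<le> real (card (shadow n k H))"
    by (simp add: field_simps)
  then show ?thesis using card_pos by (simp add: pos_le_divide_eq)
qed

end
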